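(* For the path of $n>1$ nodes, i.e. for the contact rate matrix $Q$ on $V=\{1,\dots,n\}$ with $q_{i,i+1}=q_{i+1,i}=1$ for $i=1,\dots,n-1$ and all other entries $0$, and for $\alpha\in(1/2,1)$ with $\alpha n$ an integer, $$\delta(Q,\alpha)=2\left(1-\cos\left(\frac{\pi}{4(1-\alpha)n+1}\right)\right),$$ and, for fixed $\alpha$, as $n\to\infty$ (along $n$ with $\alpha n$ an integer) this equals $$\frac{\pi^2}{16(1-\alpha)^2n^2}(1+o(1)).$$
   Context: For a symmetric matrix $Q=(q_{i,j})_{i,j\in V}$ with non-negative entries and zero diagonal and a non-empty $S\subset V$, let $S^c=V\setminus S$ and let $Q_S=(q^S_{i,j})_{i,j\in V}$ be the matrix with $q^S_{i,i}=-\sum_{l\in V}q_{i,l}$ for all $i\in V$; $q^S_{i,j}=q_{i,j}$ for $i\in S^c$, $j\neq i$; and $q^S_{i,j}=0$ for $i\in S$, $j\neq i$. Its eigenvalues are real; let $\lambda_{Q_S}$ be the largest one. With $n=|V|$, define $$\delta(Q,\alpha)=\min_{S\subset V,\ |S|/n\in[2\alpha-1,\alpha]}|\lambda_{Q_S}|=\min_{S\subset V,\ |S|=(2\alpha-1)n}|\lambda_{Q_S}|.$$ *)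

theory Defs
  imports
    "HOL-Library.Landau_Symbols"
    "Jordan_Normal_Form.Spectral_Radius"
begin

text \<open>
  A contact rate matrix on \<open>n\<close> nodes is an \<open>n \<times> n\<close> real matrix; following the
  indexing convention of the matrix library, the node set \<open>V\<close> is \<open>{..<n}\<close>.
\<close>

definition Q_sub :: "real mat \<Rightarrow> nat set \<Rightarrow> real mat" where
  "Q_sub Q S = mat (dim_row Q) (dim_row Q)
     (\<lambda>(i, j). if i = j then - (\<Sum>l<dim_row Q. Q $$ (i, l))
               else if i \<in> S then 0 else Q $$ (i, j))"

text \<open>
  Only real eigenvalues are considered, which for \<open>Q_sub Q S\<close> with symmetric \<open>Q\<close> is no
  restriction: listing the nodes outside \<open>S\<close> first, the matrix is block upper triangular, with
  a symmetric and a diagonal block on the diagonal.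
\<close>

definition max_eigenvalue :: "real mat \<Rightarrow> real" where
  "max_eigenvalue A = Max (spectrum A)"

definition delta :: "real mat \<Rightarrow> real \<Rightarrow> real" where
  "delta Q \<alpha> = Min ((\<lambda>S. \<bar>max_eigenvalue (Q_sub Q S)\<bar>) `
     {S. S \<subseteq> {..<dim_row Q} \<and> S \<noteq> {} \<and>
         real (card S) / real (dim_row Q) \<in> {2 * \<alpha> - 1..\<alpha>}})"

definition path_rates :: "nat \<Rightarrow> real mat" where
  "path_rates n = mat n n (\<lambda>(i, j). if j = i + 1 \<or> i = j + 1 then 1 else 0)"

end

theory Submission
  imports Defs "HOL-Real_Asymp.Real_Asymp"
begin

text \<open>
  An eigenvector of \<open>Q_sub Q S\<close> whose eigenvalue is not the diagonal entry of a row in \<open>S\<close>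
  vanishes on \<open>S\<close>. Off \<open>S\<close> it then satisfies the eigenvalue equation of the graph Laplacian with
  Dirichlet condition on \<open>S\<close>. On the path this problem decomposes into the maximal runs of nodes
  outside \<open>S\<close>: an interior run has Dirichlet conditions at both ends, a run that contains an end
  of the path has a Neumann condition there. With \<open>N\<close> free nodes in total, the eigenvalue closest
  to zero belongs to a single run of \<open>N\<close> nodes at one end of the path, where the eigenvector is a
  quarter period of a cosine, \<open>i \<mapsto> cos ((i + 1/2) \<theta>)\<close> with \<open>\<theta> = pi / (2 N + 1)\<close>, and the
  eigenvalue is \<open>- 2 (1 - cos \<theta>)\<close>.

  That no other \<open>S\<close> does better needs no analysis of the runs. A function that is positive off
  \<open>S\<close> and a supersolution of the eigenvalue equation for \<open>\<mu>\<close> bounds all eigenvalues by \<open>\<mu>\<close>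
  (Barta's principle, \<open>Q_sub_eigenvalue_le_of_supersolution\<close>). For the path, fix \<open>s \<in> S\<close> and give
  each free node the value \<open>cos ((c + 1/2) \<theta>)\<close>, where \<open>c\<close> counts the free nodes between it and the
  end of the path on its side of \<open>s\<close>. This is the extremal eigenvector read along the free nodes
  only. Skipping nodes of \<open>S\<close> just replaces nonnegative neighbour values by \<open>0\<close>, which keeps
  the supersolution inequality (\<open>path_eigenvalue_le\<close>). Cutting at \<open>s\<close> makes both ends of the path
  play the role of the Neumann end.

  If \<open>\<alpha> n\<close> is an integer, then the admissible sets leave at most \<open>N = 2 (1 - \<alpha>) n\<close> nodes free, so
  that \<open>2 N + 1 = 4 (1 - \<alpha>) n + 1\<close>. The asymptotics come from \<open>2 (1 - cos x) \<sim> x\<^sup>2\<close> at \<open>0\<close>.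
\<close>

section \<open>Eigenvalues of a rate matrix with absorbing nodes\<close>

text \<open>
  Because the diagonal of \<open>Q_sub Q S\<close> is minus the full row sum, the rows outside \<open>S\<close> act as a
  weighted Laplacian. In this form a constant factor can be pulled out and values compared
  neighbour by neighbour.
\<close>

lemma Q_sub_mult_vec_nth:
  assumes "Q \<in> carrier_mat n n" and "v \<in> carrier_vec n" and "i < n" and "Q $$ (i, i) = 0"
  shows "(Q_sub Q S *\<^sub>v v) $ i =
    (if i \<in> S then - (\<Sum>l<n. Q $$ (i, l)) * v $ i
     else (\<Sum>j<n. Q $$ (i, j) * (v $ j - v $ i)))"
proof -
  have "(Q_sub Q S *\<^sub>v v) $ i = (\<Sum>j<n. Q_sub Q S $$ (i, j) * v $ j)"
    using assms by (simp add: Q_sub_def scalar_prod_def atLeast0LessThan)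
  also have "\<dots> = (\<Sum>j<n. (if j = i then - (\<Sum>l<n. Q $$ (i, l)) * v $ i else 0)
      + (if i \<in> S then 0 else Q $$ (i, j) * v $ j))"
    using assms by (intro sum.cong) (auto simp: Q_sub_def)
  also have "\<dots> = - (\<Sum>l<n. Q $$ (i, l)) * v $ i
      + (if i \<in> S then 0 else (\<Sum>j<n. Q $$ (i, j) * v $ j))"
    using assms(3) by (simp add: sum.distrib)
  finally show ?thesis
    by (simp add: right_diff_distrib sum_subtractf sum_distrib_right)
qed

text \<open>
  A row supported on the diagonal makes a unit vector a left eigenvector, and a matrix and its
  transpose have the same eigenvalues.
\<close>

lemma eigenvalue_of_zero_outside_diagonal_row:
  fixes A :: "'a :: field mat"
  assumes A: "A \<in> carrier_mat n n" and "i < n"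
    and zero: "\<And>j. j < n \<Longrightarrow> j \<noteq> i \<Longrightarrow> A $$ (i, j) = 0"
  shows "eigenvalue A (A $$ (i, i))"
proof -
  have "transpose_mat A *\<^sub>v unit_vec n i = A $$ (i, i) \<cdot>\<^sub>v unit_vec n i"
    using assms by (intro eq_vecI) (auto simp: scalar_prod_right_unit)
  then have "eigenvector (transpose_mat A) (unit_vec n i) (A $$ (i, i))"
    using assms by (auto simp: eigenvector_def)
  then have "eigenvalue (transpose_mat A) (A $$ (i, i))"
    by (auto simp: eigenvalue_def)
  then show ?thesis
    using A by (simp add: eigenvalue_root_char_poly[of _ n])
qed

lemma Q_sub_carrier: "Q \<in> carrier_mat n n \<Longrightarrow> Q_sub Q S \<in> carrier_mat n n"
  by (simp add: Q_sub_def)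

text \<open>
  The maximum over the real spectrum is meaningful only if the spectrum is nonempty; any node of
  \<open>S\<close> supplies an eigenvalue.
\<close>

lemma spectrum_Q_sub_nonempty:
  assumes "Q \<in> carrier_mat n n" and "S \<subseteq> {..<n}" and "S \<noteq> {}"
  shows "spectrum (Q_sub Q S) \<noteq> {}"
proof -
  obtain i where i: "i \<in> S" "i < n" using assms by auto
  then have "eigenvalue (Q_sub Q S) (Q_sub Q S $$ (i, i))"
    using assms(1)
    by (intro eigenvalue_of_zero_outside_diagonal_row[of _ n]) (auto simp: Q_sub_def)
  then show ?thesis by (auto simp: spectrum_def)
qed

text \<open>
  Barta's principle, by comparison at a point of contact. Unless the eigenvalue is one of the
  diagonal entries for \<open>S\<close>, the eigenvector \<open>v\<close> vanishes on \<open>S\<close>. Take the node \<open>k\<close> where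
  \<open>\<bar>v\<bar> / w\<close> is largest and scale \<open>w\<close> so that it touches \<open>\<bar>v\<bar>\<close> from above at \<open>k\<close>. Replacing
  \<open>v\<close> by the scaled \<open>w\<close> in row \<open>k\<close> leaves the value at \<open>k\<close> and can only increase the
  neighbours' contributions.
\<close>

lemma Q_sub_eigenvalue_le_of_supersolution:
  assumes Q: "Q \<in> carrier_mat n n"
    and nonneg: "\<And>i j. i < n \<Longrightarrow> j < n \<Longrightarrow> 0 \<le> Q $$ (i, j)"
    and diag: "\<And>i. i < n \<Longrightarrow> Q $$ (i, i) = 0"
    and w_pos: "\<And>i. i < n \<Longrightarrow> i \<notin> S \<Longrightarrow> 0 < w i"
    and w_nonneg: "\<And>i. i < n \<Longrightarrow> i \<in> S \<Longrightarrow> 0 \<le> w i"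
    and super: "\<And>i. i < n \<Longrightarrow> i \<notin> S \<Longrightarrow> (\<Sum>j<n. Q $$ (i, j) * (w j - w i)) \<le> \<mu> * w i"
    and absorbing: "\<And>i. i < n \<Longrightarrow> i \<in> S \<Longrightarrow> - (\<Sum>l<n. Q $$ (i, l)) \<le> \<mu>"
    and eig: "eigenvalue (Q_sub Q S) \<kappa>"
  shows "\<kappa> \<le> \<mu>"
proof -
  obtain v where v: "v \<in> carrier_vec n" "v \<noteq> 0\<^sub>v n" "Q_sub Q S *\<^sub>v v = \<kappa> \<cdot>\<^sub>v v"
    using eig carrier_matD(1)[OF Q_sub_carrier[OF Q, of S]]
    by (auto simp: eigenvalue_def eigenvector_def)
  have row: "\<kappa> * v $ i = (if i \<in> S then - (\<Sum>l<n. Q $$ (i, l)) * v $ i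
     else (\<Sum>j<n. Q $$ (i, j) * (v $ j - v $ i)))" if "i < n" for i
    using Q_sub_mult_vec_nth[OF Q v(1) that diag[OF that], of S] v that by simp
  show ?thesis
  proof (cases "\<exists>i<n. i \<in> S \<and> v $ i \<noteq> 0")
    case True
    then obtain i where i: "i < n" "i \<in> S" "v $ i \<noteq> 0" by blast
    then have "(\<kappa> + (\<Sum>l<n. Q $$ (i, l))) * v $ i = 0"
      using row[OF i(1)] by (simp add: distrib_right)
    then have "\<kappa> = - (\<Sum>l<n. Q $$ (i, l))" using i(3) by simp
    then show ?thesis using absorbing[OF i(1,2)] by simp
  next
    case False
    define T where "T = {j. j < n \<and> j \<notin> S}"
    define r where "r j = \<bar>v $ j\<bar> / w j" for j
    obtain i where i: "i < n" "v $ i \<noteq> 0"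
      using v(1,2) by (metis carrier_vecD dim_vec eq_vecI index_zero_vec)
    then have iT: "i \<in> T" using False by (auto simp: T_def)
    have fin: "finite T" by (simp add: T_def)
    define c where "c = Max (r ` T)"
    have "c \<in> r ` T" unfolding c_def using fin iT by (intro Max_in) auto
    then obtain k where k: "k \<in> T" "c = r k" by blast
    have le_c: "r j \<le> c" if "j \<in> T" for j
      unfolding c_def using fin that by simp
    have wk: "0 < w k" and kn: "k < n" and kS: "k \<notin> S"
      using k w_pos by (auto simp: T_def)
    have "0 < r i" using i iT w_pos by (simp add: r_def T_def)
    then have c_pos: "0 < c" using le_c[OF iT] by simp
    have vk: "\<bar>v $ k\<bar> = c * w k" using k wk by (simp add: r_def)
    have dom: "\<bar>v $ j\<bar> \<le> c * w j" if "j < n" for j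
    proof (cases "j \<in> S")
      case True
      then have "v $ j = 0" using False that by blast
      then show ?thesis using w_nonneg[OF that True] c_pos by simp
    next
      case jS: False
      then show ?thesis
        using le_c[of j] w_pos[OF that jS] that by (simp add: T_def r_def field_simps)
    qed
    \<comment> \<open>The sign of \<open>v $ k\<close> turns the row equation at \<open>k\<close> into one for \<open>\<bar>v $ k\<bar> = c * w k\<close>.\<close>
    have "\<kappa> * (c * w k) = sgn (v $ k) * (\<kappa> * v $ k)"
      unfolding vk[symmetric] by (simp add: sgn_mult_self_eq abs_sgn mult_ac)
    also have "\<dots> = (\<Sum>j<n. Q $$ (k, j) * (sgn (v $ k) * v $ j - c * w k))"
      unfolding row[OF kn] vk[symmetric] using kS
      by (simp add: sum_distrib_left abs_sgn algebra_simps)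
    also have "\<dots> \<le> (\<Sum>j<n. Q $$ (k, j) * (c * w j - c * w k))"
    proof (intro sum_mono mult_left_mono diff_right_mono)
      fix j assume "j \<in> {..<n}"
      then have "\<bar>v $ j\<bar> \<le> c * w j" using dom by simp
      then show "sgn (v $ k) * v $ j \<le> c * w j"
        by (auto simp: sgn_if abs_le_iff intro: order_trans[OF abs_ge_zero])
    qed (use nonneg kn in auto)
    also have "\<dots> = c * (\<Sum>j<n. Q $$ (k, j) * (w j - w k))"
      by (simp add: sum_distrib_left algebra_simps)
    also have "\<dots> \<le> c * (\<mu> * w k)"
      using super[OF kn kS] c_pos by simp
    finally show ?thesis using c_pos wk by (simp add: mult.left_commute)
  qed
qed

section \<open>The cosine profile of an end segment\<close>

lemma path_rates_carrier: "path_rates n \<in> carrier_mat n n"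
  by (simp add: path_rates_def)

lemma sum_path_rates:
  assumes "i < n"
  shows "(\<Sum>j<n. path_rates n $$ (i, j) * f j) =
    (if 0 < i then f (i - 1) else 0) + (if i + 1 < n then f (i + 1) else 0)"
proof -
  have "(\<Sum>j<n. path_rates n $$ (i, j) * f j) =
      (\<Sum>j<n. (if j = i - 1 then if 0 < i then f (i - 1) else 0 else 0)
        + (if j = i + 1 then f (i + 1) else 0))"
    using assms by (intro sum.cong) (auto simp: path_rates_def)
  then show ?thesis using assms by (auto simp: sum.distrib)
qed

text \<open>
  A run of \<open>N\<close> nodes at an end of the path has its Neumann reflection point at \<open>- 1/2\<close> and its
  Dirichlet node at \<open>N\<close>. The angle per node is chosen so that this distance \<open>N + 1/2\<close> is a quarter
  turn.
\<close>

definition segment_angle :: "nat \<Rightarrow> real" where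
  "segment_angle N = pi / (2 * real N + 1)"

text \<open>
  The position is a real number so that \<open>x - 1\<close> is available at \<open>x = 0\<close>, where it is the
  reflected neighbour of the end node.
\<close>

definition cos_profile :: "nat \<Rightarrow> real \<Rightarrow> real" where
  "cos_profile N x = cos ((x + 1 / 2) * segment_angle N)"

lemma cos_profile_recurrence:
  "cos_profile N (x - 1) + cos_profile N (x + 1) - 2 * cos_profile N x
     = - 2 * (1 - cos (segment_angle N)) * cos_profile N x"
proof -
  define a where "a = (x + 1 / 2) * segment_angle N"
  have "cos_profile N (x - 1) = cos (a - segment_angle N)"
    and "cos_profile N (x + 1) = cos (a + segment_angle N)"
    and "cos_profile N x = cos a"
    by (simp_all add: cos_profile_def a_def algebra_simps)
  then show ?thesis by (simp add: cos_add cos_diff algebra_simps)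
qed

lemma segment_angle_pos: "0 < segment_angle N"
  by (simp add: segment_angle_def add_nonneg_pos)

lemma segment_angle_quarter_turn: "(real N + 1 / 2) * segment_angle N = pi / 2"
  by (simp add: segment_angle_def field_simps)

lemma cos_profile_pos:
  assumes "- (real N + 1) < x" and "x < real N"
  shows "0 < cos_profile N x"
  unfolding cos_profile_def
proof (rule cos_gt_zero_pi)
  have "- (real N + 1 / 2) * segment_angle N < (x + 1 / 2) * segment_angle N"
    by (rule mult_strict_right_mono[OF _ segment_angle_pos]) (use assms in linarith)
  then show "- (pi / 2) < (x + 1 / 2) * segment_angle N"
    unfolding mult_minus_left segment_angle_quarter_turn .
  have "(x + 1 / 2) * segment_angle N < (real N + 1 / 2) * segment_angle N"
    by (rule mult_strict_right_mono[OF _ segment_angle_pos]) (use assms in linarith)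
  then show "(x + 1 / 2) * segment_angle N < pi / 2"
    unfolding segment_angle_quarter_turn .
qed

lemma cos_profile_at_end: "cos_profile N (real N) = 0"
  by (simp add: cos_profile_def segment_angle_quarter_turn)

text \<open>
  The Neumann condition: the fictitious neighbour of the end node carries the same value, so a
  missing neighbour contributes to the Laplacian exactly what the recurrence prescribes.
\<close>

lemma cos_profile_reflect: "cos_profile N (- 1) = cos_profile N 0"
  by (simp add: cos_profile_def)

text \<open>
  This puts \<open>- 2 (1 - cos \<theta>)\<close> at or above \<open>- 1\<close>, hence at or above every diagonal
  entry of a path with more than one node, all degrees there being at least \<open>1\<close>.
\<close>

lemma cos_segment_angle_ge_half: "1 \<le> N \<Longrightarrow> 1 / 2 \<le> cos (segment_angle N)"
proof -
  assume "1 \<le> N"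
  then have "segment_angle N \<le> pi / 3"
    unfolding segment_angle_def by (intro divide_left_mono) auto
  moreover have "0 \<le> segment_angle N" by (simp add: segment_angle_def)
  ultimately have "cos (pi / 3) \<le> cos (segment_angle N)"
    by (intro cos_monotone_0_pi_le) auto
  then show ?thesis by (simp add: cos_60)
qed

section \<open>The extremal absorbing sets of the path\<close>

text \<open>
  The supersolution is the cosine profile evaluated at the number of free nodes between \<open>i\<close> and
  the end of the path on its side of \<open>s\<close>. One step between free nodes changes this number by
  exactly one. There are at most \<open>N\<close> free nodes, so the number stays below \<open>N\<close>, where the profile
  is positive. A neighbour in \<open>S\<close> has value \<open>0\<close>, which is at most the profile value expected
  there, and an end node has the Neumann reflection in place of a neighbour.
\<close>

lemma path_eigenvalue_le:
  assumes n: "1 < n" and S: "S \<subseteq> {..<n}" "S \<noteq> {}" and N: "1 \<le> N" "card ({..<n} - S) \<le> N"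
    and eig: "eigenvalue (Q_sub (path_rates n) S) \<kappa>"
  shows "\<kappa> \<le> - 2 * (1 - cos (segment_angle N))"
proof -
  obtain s where s: "s \<in> S" "s < n" using S by auto
  define free where
    "free i = (if i < s then card ({..<i} - S) else card ({i<..<n} - S))" for i
  define w where "w i = (if i \<in> S then 0 else cos_profile N (real (free i)))" for i
  have free_less: "free i < N" if "i < n" "i \<notin> S" for i
  proof -
    define B where "B = (if i < s then {..<i} - S else {i<..<n} - S)"
    have "B \<subseteq> {..<n} - S" and "i \<notin> B" and "i \<in> {..<n} - S"
      using that by (auto simp: B_def)
    then have "B \<subset> {..<n} - S" by blast
    then have "card B < card ({..<n} - S)" by (intro psubset_card_mono) auto
    moreover have "free i = card B" by (simp add: free_def B_def)
    ultimately show ?thesis using N by simp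
  qed
  have profile_nonneg: "0 \<le> cos_profile N x" if "- 1 \<le> x" "x \<le> real N" for x
    using cos_profile_pos[of N x] cos_profile_at_end[of N] that N(1)
    by (cases "x = real N") (auto intro: less_imp_le)
  have w_eq: "w i = cos_profile N (real (free i))" if "i \<notin> S" for i
    using that by (simp add: w_def)
  \<comment> \<open>The neighbour of \<open>i\<close> in the direction of \<open>s\<close> and the one in the direction of the end of the
    path: each carries at most the value that continues the profile.\<close>
  have toward: "w j \<le> cos_profile N (real (free i) + 1)"
    if "i < n" "i \<notin> S" "j \<notin> S \<Longrightarrow> free j = Suc (free i)" for i j
    using that free_less[OF that(1,2)] profile_nonneg[of "real (free i) + 1"]
    by (cases "j \<in> S") (auto simp: w_def add.commute)
  have away: "w j \<le> cos_profile N (real (free i) - 1)"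
    if "i < n" "i \<notin> S" "j \<notin> S \<Longrightarrow> free i = Suc (free j)" for i j
    using that free_less[OF that(1,2)] profile_nonneg[of "real (free i) - 1"]
    by (cases "j \<in> S") (auto simp: w_def)
  have left_Suc: "card ({..<Suc i} - S) = Suc (card ({..<i} - S))" if "i \<notin> S" for i
    using that by (simp add: lessThan_Suc insert_Diff_if)
  have right_Suc: "card ({i<..<n} - S) = Suc (card ({Suc i<..<n} - S))"
    if "Suc i \<notin> S" "Suc i < n" for i
  proof -
    have "{i<..<n} = insert (Suc i) {Suc i<..<n}" using that by auto
    then show ?thesis using that by (simp add: insert_Diff_if)
  qed
  have super: "(\<Sum>j<n. path_rates n $$ (i, j) * (w j - w i))
      \<le> - 2 * (1 - cos (segment_angle N)) * w i" if i: "i < n" "i \<notin> S" for i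
  proof -
    note rec = cos_profile_recurrence[of N "real (free i)"]
    have "i \<noteq> s" using i s by auto
    then consider "i < s" | "s < i" by linarith
    then have "(if 0 < i then w (i - 1) - w i else 0) + (if i + 1 < n then w (i + 1) - w i else 0)
      \<le> cos_profile N (real (free i) - 1) + cos_profile N (real (free i) + 1) - 2 * w i"
    proof cases
      case 1
      have "i + 1 \<noteq> s" if "i + 1 \<notin> S" using that s by auto
      then have "w (i + 1) \<le> cos_profile N (real (free i) + 1)"
        using 1 i left_Suc[of i] by (intro toward) (auto simp: free_def)
      moreover have "w (i - 1) \<le> cos_profile N (real (free i) - 1)" if "0 < i"
        using 1 i that left_Suc[of "i - 1"] by (intro away) (auto simp: free_def)
      moreover have "w i = cos_profile N (real (free i) - 1)" if "i = 0"
        using that 1 i by (simp add: w_def free_def cos_profile_reflect)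
      ultimately show ?thesis using 1 s by auto
    next
      case 2
      have "i - 1 \<noteq> s" if "i - 1 \<notin> S" using that s by auto
      then have "w (i - 1) \<le> cos_profile N (real (free i) + 1)"
        using 2 i right_Suc[of "i - 1"] by (intro toward) (auto simp: free_def)
      moreover have "w (i + 1) \<le> cos_profile N (real (free i) - 1)" if "i + 1 < n"
        using 2 i that right_Suc[of i] by (intro away) (auto simp: free_def)
      moreover have "w i = cos_profile N (real (free i) - 1)" if "\<not> i + 1 < n"
      proof -
        have "{i<..<n} = {}" using that by auto
        then show ?thesis using 2 i by (simp add: w_def free_def cos_profile_reflect)
      qed
      ultimately show ?thesis using 2 by auto
    qed
    then show ?thesis using rec sum_path_rates[OF i(1), of "\<lambda>j. w j - w i"] w_eq[OF i(2)] i
      by simp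
  qed
  have absorbing: "- (\<Sum>l<n. path_rates n $$ (i, l)) \<le> - 2 * (1 - cos (segment_angle N))"
    if "i < n" for i
  proof -
    have "1 \<le> (\<Sum>l<n. path_rates n $$ (i, l))"
      using sum_path_rates[OF that, of "\<lambda>_. 1"] n that by (auto split: if_splits)
    then show ?thesis using cos_segment_angle_ge_half[OF N(1)] by simp
  qed
  show ?thesis
  proof (rule Q_sub_eigenvalue_le_of_supersolution[where w = w and S = S and n = n])
    show "0 < w i" if "i < n" "i \<notin> S" for i
      using free_less[OF that] w_eq[OF that(2)] by (simp add: cos_profile_pos)
    show "0 \<le> path_rates n $$ (i, j)" if "i < n" "j < n" for i j
      using that by (simp add: path_rates_def)
    show "path_rates n $$ (i, i) = 0" if "i < n" for i
      using that by (simp add: path_rates_def)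
    show "0 \<le> w i" if "i \<in> S" for i
      using that by (simp add: w_def)
    show "- (\<Sum>l<n. path_rates n $$ (i, l)) \<le> - 2 * (1 - cos (segment_angle N))"
      if "i < n" for i
      using absorbing[OF that] .
  qed (fact path_rates_carrier super eig)+
qed

text \<open>
  The bound is attained when the free nodes form one end segment: extended by zero, the profile is
  an exact eigenvector, since its zero falls on the first node of \<open>S\<close>.
\<close>

lemma path_end_segment_eigenvalue:
  assumes "1 \<le> N" and "N < n"
  shows "eigenvalue (Q_sub (path_rates n) {N..<n}) (- 2 * (1 - cos (segment_angle N)))"
proof -
  define v where "v = vec n (\<lambda>i. if i < N then cos_profile N (real i) else 0)"
  let ?\<mu> = "- 2 * (1 - cos (segment_angle N))"
  have "0 < v $ 0" using assms cos_profile_pos[of N 0] by (simp add: v_def)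
  then have "v \<noteq> 0\<^sub>v n" using assms by force
  moreover have "Q_sub (path_rates n) {N..<n} *\<^sub>v v = ?\<mu> \<cdot>\<^sub>v v"
  proof (rule eq_vecI)
    fix i assume "i < dim_vec (?\<mu> \<cdot>\<^sub>v v)"
    then have i: "i < n" by (simp add: v_def)
    have vn: "v \<in> carrier_vec n" by (simp add: v_def)
    have diag: "path_rates n $$ (i, i) = 0" using i by (simp add: path_rates_def)
    show "(Q_sub (path_rates n) {N..<n} *\<^sub>v v) $ i = (?\<mu> \<cdot>\<^sub>v v) $ i"
    proof (cases "i < N")
      case False
      then show ?thesis
        using Q_sub_mult_vec_nth[OF path_rates_carrier vn i diag, of "{N..<n}"] i
        by (simp add: v_def)
    next
      case True
      have "v $ (i + 1) = cos_profile N (real i + 1)"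
      proof (cases "i + 1 = N")
        case True
        then have "real i + 1 = real N" by simp
        then have "cos_profile N (real i + 1) = 0" using cos_profile_at_end[of N] by (simp only:)
        moreover have "v $ (i + 1) = 0" using True assms by (simp add: v_def)
        ultimately show ?thesis by (simp only:)
      next
        case False
        then show ?thesis using \<open>i < N\<close> assms by (simp add: v_def add.commute)
      qed
      moreover have "v $ i = cos_profile N (real i)" using True i by (simp add: v_def)
      moreover have "v $ (i - 1) = cos_profile N (real i - 1)" if "0 < i"
        using that True assms by (simp add: v_def of_nat_diff)
      moreover have "v $ i = cos_profile N (real i - 1)" if "i = 0"
        using that assms by (simp add: v_def cos_profile_reflect)
      ultimately have "(if 0 < i then v $ (i - 1) - v $ i else 0)
          + (if i + 1 < n then v $ (i + 1) - v $ i else 0) = ?\<mu> * v $ i"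
        using cos_profile_recurrence[of N "real i"] True assms by auto
      then show ?thesis
        using Q_sub_mult_vec_nth[OF path_rates_carrier vn i diag, of "{N..<n}"] i True
          sum_path_rates[OF i, of "\<lambda>j. v $ j - v $ i"] vn
        by simp
    qed
  qed (simp add: v_def Q_sub_def path_rates_def)
  ultimately have "eigenvector (Q_sub (path_rates n) {N..<n}) v ?\<mu>"
    by (simp add: eigenvector_def v_def Q_sub_def path_rates_def)
  then show ?thesis by (auto simp: eigenvalue_def)
qed

lemma max_eigenvalue_path_le:
  assumes "1 < n" and "S \<subseteq> {..<n}" "S \<noteq> {}" and "1 \<le> N" "card ({..<n} - S) \<le> N"
  shows "max_eigenvalue (Q_sub (path_rates n) S) \<le> - 2 * (1 - cos (segment_angle N))"
proof -
  note carr = Q_sub_carrier[OF path_rates_carrier]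
  have "max_eigenvalue (Q_sub (path_rates n) S) \<in> spectrum (Q_sub (path_rates n) S)"
    unfolding max_eigenvalue_def
    using card_finite_spectrum(1)[OF carr] spectrum_Q_sub_nonempty[OF path_rates_carrier assms(2,3)]
    by (intro Max_in) auto
  then show ?thesis using path_eigenvalue_le[OF assms] by (simp add: spectrum_def)
qed

lemma max_eigenvalue_path_end_segment:
  assumes "1 \<le> N" and "N < n"
  shows "max_eigenvalue (Q_sub (path_rates n) {N..<n}) = - 2 * (1 - cos (segment_angle N))"
proof (rule antisym)
  have "{..<n} - {N..<n} = {..<N}" using assms by auto
  then have "card ({..<n} - {N..<n}) \<le> N" by simp
  moreover have "1 < n" and "{N..<n} \<subseteq> {..<n}" and "{N..<n} \<noteq> {}" using assms by auto
  ultimately show "max_eigenvalue (Q_sub (path_rates n) {N..<n}) \<le> - 2 * (1 - cos (segment_angle N))"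
    using max_eigenvalue_path_le[OF _ _ _ assms(1)] by blast
  show "- 2 * (1 - cos (segment_angle N)) \<le> max_eigenvalue (Q_sub (path_rates n) {N..<n})"
    unfolding max_eigenvalue_def
    using card_finite_spectrum(1)[OF Q_sub_carrier[OF path_rates_carrier]]
      path_end_segment_eigenvalue[OF assms]
    by (intro Max_ge) (auto simp: spectrum_def)
qed

section \<open>The value of delta and its asymptotics\<close>

text \<open>
  The lower end of the admissible range of \<open>card S\<close> is the integer \<open>n - N\<close> with
  \<open>N = 2 (1 - \<alpha>) n\<close>. So every admissible set leaves at most \<open>N\<close> nodes free, and
  \<open>{N..<n}\<close>, which leaves exactly the first \<open>N\<close> nodes free, is admissible. All maximal eigenvalues are
  at most \<open>- 2 (1 - cos \<theta>) \<le> 0\<close>, so taking absolute values reverses their order.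
\<close>

lemma delta_path_rates:
  fixes \<alpha> :: real
  assumes \<alpha>: "1 / 2 < \<alpha>" "\<alpha> < 1" and n: "1 < n" and int: "\<alpha> * real n \<in> \<int>"
  shows "delta (path_rates n) \<alpha> = 2 * (1 - cos (pi / (4 * (1 - \<alpha>) * real n + 1)))"
proof -
  have "(1 - \<alpha>) * real n \<in> \<int>" using int by (simp add: left_diff_distrib)
  moreover have "0 < (1 - \<alpha>) * real n" using \<alpha> n by simp
  ultimately obtain m :: nat where m: "(1 - \<alpha>) * real n = real m"
    by (metis Ints_cases less_imp_le of_int_0_le_iff of_int_of_nat_eq zero_le_imp_eq_int)
  define N where "N = 2 * m"
  have N1: "1 \<le> N" using m \<open>0 < (1 - \<alpha>) * real n\<close> by (simp add: N_def)
  \<comment> \<open>The condition \<open>\<alpha> > 1 / 2\<close> is what keeps \<open>{N..<n}\<close> nonempty.\<close>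
  have "\<alpha> * real n > 1 / 2 * real n" using \<alpha> n by (intro mult_strict_right_mono) auto
  then have Nn: "N < n" using m by (simp add: N_def algebra_simps)
  have angle: "pi / (4 * (1 - \<alpha>) * real n + 1) = segment_angle N"
  proof -
    have "4 * (1 - \<alpha>) * real n = 2 * real N" using m by (simp add: N_def algebra_simps)
    then show ?thesis by (simp add: segment_angle_def)
  qed
  have lower: "(2 * \<alpha> - 1) * real n = real n - real N"
    using m by (simp add: N_def algebra_simps)
  let ?F = "{S. S \<subseteq> {..<n} \<and> S \<noteq> {} \<and> real (card S) / real n \<in> {2 * \<alpha> - 1..\<alpha>}}"
  let ?f = "\<lambda>S. \<bar>max_eigenvalue (Q_sub (path_rates n) S)\<bar>"
  have "Min (?f ` ?F) = 2 * (1 - cos (segment_angle N))"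
  proof (rule Min_eqI)
    show "finite (?f ` ?F)" by (intro finite_imageI) simp
  next
    fix y assume "y \<in> ?f ` ?F"
    then obtain S where S: "S \<subseteq> {..<n}" "S \<noteq> {}" "2 * \<alpha> - 1 \<le> real (card S) / real n"
      and y: "y = ?f S" by auto
    have "(2 * \<alpha> - 1) * real n \<le> real (card S)"
      using S(3) n by (simp add: field_simps)
    then have "card ({..<n} - S) \<le> N"
      using lower Nn S(1) finite_subset[OF S(1)] by (simp add: card_Diff_subset)
    then show "2 * (1 - cos (segment_angle N)) \<le> y"
      using max_eigenvalue_path_le[OF n S(1,2) N1] y by simp
  next
    have "2 * \<alpha> - 1 = (real n - real N) / real n"
      using lower n by (simp add: field_simps)
    moreover have "2 * \<alpha> - 1 \<le> \<alpha>" using \<alpha> by simp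
    ultimately have "{N..<n} \<in> ?F" using Nn by (auto simp: of_nat_diff)
    moreover have "?f {N..<n} = 2 * (1 - cos (segment_angle N))"
      using max_eigenvalue_path_end_segment[OF N1 Nn] cos_le_one[of "segment_angle N"] by simp
    ultimately show "2 * (1 - cos (segment_angle N)) \<in> ?f ` ?F" by (metis (no_types, lifting) image_eqI)
  qed
  then show ?thesis
    by (simp only: delta_def angle carrier_matD(1)[OF path_rates_carrier])
qed

text \<open>
  The expansion \<open>2 (1 - cos x) \<sim> x\<^sup>2\<close> at \<open>0\<close> is composed with the vanishing angle.
\<close>

lemma segment_angle_asymptotics:
  fixes c :: real
  assumes "0 < c"
  shows "(\<lambda>n. 2 * (1 - cos (pi / (c * real n + 1)))) \<sim>[at_top] (\<lambda>n. pi\<^sup>2 / (c\<^sup>2 * (real n)\<^sup>2))"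
proof -
  have "(\<lambda>x::real. 2 * (1 - cos x)) \<sim>[at_right 0] (\<lambda>x. x\<^sup>2)"
    by real_asymp
  moreover have "filterlim (\<lambda>n. pi / (c * real n + 1)) (at_right 0) at_top"
    using assms by real_asymp
  ultimately have "(\<lambda>n. 2 * (1 - cos (pi / (c * real n + 1))))
      \<sim>[at_top] (\<lambda>n. (pi / (c * real n + 1))\<^sup>2)"
    by (rule asymp_equiv_compose')
  also have "(\<lambda>n. (pi / (c * real n + 1))\<^sup>2) \<sim>[at_top] (\<lambda>n. pi\<^sup>2 / (c\<^sup>2 * (real n)\<^sup>2))"
  proof -
    have "(\<lambda>n. pi / (c * real n + 1)) \<sim>[at_top] (\<lambda>n. pi / (c * real n))"
      using assms by real_asymp
    from asymp_equiv_power[OF this, of 2] show ?thesis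
      by (simp add: power_divide power_mult_distrib)
  qed
  finally show ?thesis .
qed

theorem lemma3:
  fixes \<alpha> :: real
  assumes "1 / 2 < \<alpha>" and "\<alpha> < 1"
  shows "(\<forall>n::nat. 1 < n \<longrightarrow> \<alpha> * real n \<in> \<int> \<longrightarrow>
            delta (path_rates n) \<alpha> = 2 * (1 - cos (pi / (4 * (1 - \<alpha>) * real n + 1))))
       \<and> (\<lambda>n. delta (path_rates n) \<alpha>)
            \<sim>[inf at_top (principal {n::nat. \<alpha> * real n \<in> \<int>})]
            (\<lambda>n. pi\<^sup>2 / (16 * (1 - \<alpha>)\<^sup>2 * (real n)\<^sup>2))"
proof
  show "\<forall>n::nat. 1 < n \<longrightarrow> \<alpha> * real n \<in> \<int> \<longrightarrow>
      delta (path_rates n) \<alpha> = 2 * (1 - cos (pi / (4 * (1 - \<alpha>) * real n + 1)))"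
    using delta_path_rates assms by blast
  let ?F = "inf at_top (principal {n::nat. \<alpha> * real n \<in> \<int>})"
  have "(\<lambda>n. 2 * (1 - cos (pi / (4 * (1 - \<alpha>) * real n + 1))))
      \<sim>[?F] (\<lambda>n. pi\<^sup>2 / ((4 * (1 - \<alpha>))\<^sup>2 * (real n)\<^sup>2))"
  \<comment> \<open>Composition with the identity restricts an equivalence to a finer filter.\<close>
  proof (rule asymp_equiv_compose'[where h = "\<lambda>n. n"])
    show "filterlim (\<lambda>n. n) at_top ?F" by (simp add: filterlim_def)
  qed (use segment_angle_asymptotics[of "4 * (1 - \<alpha>)"] assms in simp)
  moreover have "(4 * (1 - \<alpha>))\<^sup>2 = 16 * (1 - \<alpha>)\<^sup>2"
    unfolding power_mult_distrib by simp
  ultimately have equiv: "(\<lambda>n. 2 * (1 - cos (pi / (4 * (1 - \<alpha>) * real n + 1))))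
      \<sim>[?F] (\<lambda>n. pi\<^sup>2 / (16 * (1 - \<alpha>)\<^sup>2 * (real n)\<^sup>2))"
    by (simp only:)
  have "\<forall>\<^sub>F n in ?F. delta (path_rates n) \<alpha>
      = 2 * (1 - cos (pi / (4 * (1 - \<alpha>) * real n + 1)))"
    unfolding eventually_inf_principal using eventually_gt_at_top[of 1]
    by eventually_elim (use delta_path_rates assms in auto)
  then show "(\<lambda>n. delta (path_rates n) \<alpha>) \<sim>[?F]
      (\<lambda>n. pi\<^sup>2 / (16 * (1 - \<alpha>)\<^sup>2 * (real n)\<^sup>2))"
    by (rule asymp_equiv_trans[OF asymp_equiv_refl_ev equiv])
qed

end
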